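(* Let $n\ge1$. The association $(\mathcal{G},c)\mapsto\Phi^{\mathcal{G},c}$ restricts to a bijection between Levigraphs (of type $BC$) on the set of nodes $\{1,\dots,n\}$ and Levi subsystems of $BC_n$.
   Context: Let $V=\mathbb{C}^n$ with canonical basis $(e_i)$, orthonormal for the scalar product, $e^\pm_{ij}=e_i\pm e_j$, and $BC_n=\{\pm e^-_{ij},\pm e^+_{ij}: i\ne j\}\cup\{\pm e_i,\pm2e_i\}$. A root subsystem is a subset $\Phi'\subseteq BC_n$ stable under the orthogonal reflections defined by its elements. A Levi subsystem of $BC_n$ is a root subsystem $\Phi'$ with $\mathrm{span}_{\mathbb{C}}(\Phi')\cap BC_n=\Phi'$. A bichromatic graph $(\mathcal{G},c)$ on nodes $\{1,\dots,n\}$ has unoriented straight edges $\{i,j\}$ ($i\ne j$) and loop edges $\{k\}$, each coloured red or green, such that two distinct edges with the same underlying node set have different colours. The set $\Phi^{\mathcal{G},c}\subseteq BC_n$ consists exactly of $\pm e^-_{ij}$ for each red straight edge $\{i,j\}$, $\pm e^+_{ij}$ for each green straight edge $\{i,j\}$, $\pm e_k$ for each red loop at $k$, and $\pm2e_k$ for each green loop at $k$. A bichromatic graph is a crystallograph if: (i) for any three distinct nodes $i,j,k$, if there are straight edges $\{i,j\}$, $\{j,k\}$ then there is a straight edge $\{i,k\}$, red if the first two have the same colour and green otherwise; (ii) if a node $i$ is incident to a loop edge and to a straight edge $\{i,j\}$, then both the red and the green straight edge $\{i,j\}$ are present, as well as a loop edge at $j$ of the same colour as the one at $i$. A Levigraph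 (of type $BC$) is a crystallograph such that: (1) if a node is incident to a loop edge, then it is incident to two loop edges (one red, one green); (2) if the graph contains both a red and a green straight edge between two nodes, then it contains both the red and the green loop edge at each of these nodes; (3) if two distinct nodes are incident to loop edges, then both the red and the green straight edge between them are present. *)

theory Defs
  imports "HOL-Analysis.Analysis"
begin

text \<open>The node set \<open>{1,...,n}\<close> with \<open>n \<ge> 1\<close> is the universe of a finite type \<open>'n\<close>
  (so \<open>n = CARD('n)\<close>), and the vector space is \<open>complex ^ 'n\<close>, with scalar multiplication
  \<open>(*s)\<close> and complex span \<open>vec.span\<close>. (The constant \<open>span\<close> would be the real span.)\<close>

abbreviation basis_vec :: "'n::finite \<Rightarrow> complex ^ 'n" where
  "basis_vec i \<equiv> axis i 1"

definition eminus :: "'n::finite \<Rightarrow> 'n \<Rightarrow> complex ^ 'n" where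
  "eminus i j = basis_vec i - basis_vec j"

definition eplus :: "'n::finite \<Rightarrow> 'n \<Rightarrow> complex ^ 'n" where
  "eplus i j = basis_vec i + basis_vec j"

definition BC_roots :: "(complex ^ 'n::finite) set" where
  "BC_roots =
     {v. \<exists>i j. i \<noteq> j \<and>
           (v = eminus i j \<or> v = - eminus i j \<or> v = eplus i j \<or> v = - eplus i j)} \<union>
     {v. \<exists>i. v = basis_vec i \<or> v = - basis_vec i \<or>
             v = 2 *s basis_vec i \<or> v = - (2 *s basis_vec i)}"

text \<open>The library's \<open>inner\<close> on \<open>complex ^ 'n\<close> is only the real part of the Hermitian product.\<close>

definition scalar_prod :: "complex ^ 'n::finite \<Rightarrow> complex ^ 'n \<Rightarrow> complex" where
  "scalar_prod v w = (\<Sum>i\<in>UNIV. v $ i * cnj (w $ i))"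

definition orth_reflection :: "complex ^ 'n::finite \<Rightarrow> complex ^ 'n \<Rightarrow> complex ^ 'n" where
  "orth_reflection a v = v - (2 * scalar_prod v a / scalar_prod a a) *s a"

definition root_subsystem :: "(complex ^ 'n::finite) set \<Rightarrow> bool" where
  "root_subsystem P \<longleftrightarrow> P \<subseteq> BC_roots \<and> (\<forall>a\<in>P. orth_reflection a ` P \<subseteq> P)"

definition levi_subsystem :: "(complex ^ 'n::finite) set \<Rightarrow> bool" where
  "levi_subsystem P \<longleftrightarrow> root_subsystem P \<and> vec.span P \<inter> BC_roots = P"

datatype colour = Red | Green

text \<open>Two edges with the same underlying node set have different colours, so a coloured edge
  is determined by its node set and its colour. A bichromatic graph is therefore represented by
  its set of coloured edges \<open>(S, c)\<close>, where \<open>S\<close> is \<open>{i, j}\<close> with \<open>i \<noteq> j\<close> (a straight edge)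
  or \<open>{k}\<close> (a loop).\<close>

type_synonym 'n coloured_edges = "('n set \<times> colour) set"

definition bichromatic_graph :: "'n coloured_edges \<Rightarrow> bool" where
  "bichromatic_graph G \<longleftrightarrow>
     (\<forall>(S, c)\<in>G. (\<exists>i j. i \<noteq> j \<and> S = {i, j}) \<or> (\<exists>k. S = {k}))"

definition straight :: "'n coloured_edges \<Rightarrow> 'n \<Rightarrow> 'n \<Rightarrow> colour \<Rightarrow> bool" where
  "straight G i j c \<longleftrightarrow> i \<noteq> j \<and> ({i, j}, c) \<in> G"

definition loop :: "'n coloured_edges \<Rightarrow> 'n \<Rightarrow> colour \<Rightarrow> bool" where
  "loop G k c \<longleftrightarrow> ({k}, c) \<in> G"

definition graph_roots :: "'n::finite coloured_edges \<Rightarrow> (complex ^ 'n) set" where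
  "graph_roots G =
     {v. \<exists>i j. straight G i j Red \<and> (v = eminus i j \<or> v = - eminus i j)} \<union>
     {v. \<exists>i j. straight G i j Green \<and> (v = eplus i j \<or> v = - eplus i j)} \<union>
     {v. \<exists>k. loop G k Red \<and> (v = basis_vec k \<or> v = - basis_vec k)} \<union>
     {v. \<exists>k. loop G k Green \<and> (v = 2 *s basis_vec k \<or> v = - (2 *s basis_vec k))}"

definition crystallograph :: "'n coloured_edges \<Rightarrow> bool" where
  "crystallograph G \<longleftrightarrow> bichromatic_graph G \<and>
     (\<forall>i j k c d. i \<noteq> j \<and> j \<noteq> k \<and> i \<noteq> k \<and> straight G i j c \<and> straight G j k d \<longrightarrow>
        straight G i k (if c = d then Red else Green)) \<and>
     (\<forall>i j c d. loop G i c \<and> straight G i j d \<longrightarrow>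
        straight G i j Red \<and> straight G i j Green \<and> loop G j c)"

definition levigraph :: "'n coloured_edges \<Rightarrow> bool" where
  "levigraph G \<longleftrightarrow> crystallograph G \<and>
     (\<forall>i. (\<exists>c. loop G i c) \<longrightarrow> loop G i Red \<and> loop G i Green) \<and>
     (\<forall>i j. straight G i j Red \<and> straight G i j Green \<longrightarrow>
        loop G i Red \<and> loop G i Green \<and> loop G j Red \<and> loop G j Green) \<and>
     (\<forall>i j. i \<noteq> j \<and> (\<exists>c. loop G i c) \<and> (\<exists>d. loop G j d) \<longrightarrow>
        straight G i j Red \<and> straight G i j Green)"

end

theory Submission
  imports Defs
begin

text \<open>
  Attach to a straight edge \<open>{i, j}\<close> of colour \<open>c\<close> the root \<open>e\<^sub>i - \<sigma> e\<^sub>j\<close>, where the sign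
  \<open>\<sigma>\<close> is \<open>1\<close> for red and \<open>- 1\<close> for green; with this convention the composition rule of
  crystallographs is multiplication of signs.

  The reflections defined by roots permute the lines of the canonical basis, so they preserve
  \<open>BC_roots\<close>; they also preserve the span of any set that contains the root. Hence every set \<open>P\<close>
  with \<open>span P \<inter> BC_roots = P\<close> is automatically a root subsystem
  (\<open>levi_subsystem_iff_span_closed\<close>), and only span closure has to be discussed.

  From subsystems to graphs: a Levi subsystem is determined by its edge and loop roots, because
  it is closed under negation, and each Levigraph axiom says that some root is a linear
  combination of others (\<open>levigraph_graph_of_roots\<close>). In particular, \<open>e\<^sub>k\<close> and \<open>2 e\<^sub>k\<close> span
  the same line, which explains why loops come in pairs.

  From graphs to subsystems: the span of the roots of a Levigraph is cut out by one linear
  equation for each node \<open>k\<close> without loops, namely that the coordinates over the component of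
  \<open>k\<close>, weighted by the signs of the edges from \<open>k\<close>, sum to \<open>0\<close>
  (\<open>node_equation_graph_roots\<close>). A root satisfying all of these equations must already be
  attached to the graph: evaluating the equation at an endpoint without loops forces the edge to
  be present, and between nodes with loops all edges are present.
\<close>

section \<open>Roots attached to edges and loops\<close>

definition edge_sign :: "colour \<Rightarrow> complex" where
  "edge_sign c = (case c of Red \<Rightarrow> 1 | Green \<Rightarrow> - 1)"

definition edge_root :: "'n::finite \<Rightarrow> 'n \<Rightarrow> colour \<Rightarrow> complex ^ 'n" where
  "edge_root i j c = basis_vec i - edge_sign c *s basis_vec j"

definition loop_coeff :: "colour \<Rightarrow> complex" where
  "loop_coeff c = (case c of Red \<Rightarrow> 1 | Green \<Rightarrow> 2)"

definition loop_root :: "'n::finite \<Rightarrow> colour \<Rightarrow> complex ^ 'n" where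
  "loop_root k c = loop_coeff c *s basis_vec k"

lemma edge_sign_simps [simp]:
  "edge_sign Red = 1" "edge_sign Green = - 1" "edge_sign c \<noteq> 0"
  "edge_sign c * edge_sign c = 1"
  by (cases c; simp add: edge_sign_def)+

lemma loop_coeff_simps [simp]:
  "loop_coeff Red = 1" "loop_coeff Green = 2" "loop_coeff c \<noteq> 0"
  by (cases c; simp add: loop_coeff_def)+

lemma edge_sign_compose:
  "edge_sign (if c = d then Red else Green) = edge_sign c * edge_sign d"
  by (cases c; cases d) (auto simp: edge_sign_def)

lemma edge_sign_inject: "edge_sign c = edge_sign d \<longleftrightarrow> c = d"
  by (cases c; cases d) (auto simp: edge_sign_def)

lemma edge_root_simps:
  "edge_root i j Red = eminus i j" "edge_root i j Green = eplus i j"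
  by (auto simp: edge_root_def eminus_def eplus_def vec_eq_iff)

lemma loop_root_simps:
  "loop_root k Red = basis_vec k" "loop_root k Green = 2 *s basis_vec k"
  by (auto simp: loop_root_def vec_eq_iff)

lemma edge_root_commute: "edge_root j i c = - (edge_sign c *s edge_root i j c)"
  by (cases c) (auto simp: edge_root_def vec_eq_iff)

lemma basis_vec_nth: "basis_vec k $ l = (if l = k then 1 else 0)"
  by (simp add: axis_def)

lemma edge_root_nth:
  "edge_root i j c $ l = (if l = i then 1 else 0) - edge_sign c * (if l = j then 1 else 0)"
  by (simp add: edge_root_def axis_def)

lemma loop_root_nth:
  "loop_root k c $ l = (if l = k then loop_coeff c else 0)"
  by (simp add: loop_root_def axis_def)

lemma ex_colour: "(\<exists>c. P c) \<longleftrightarrow> P Red \<or> P Green"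
  by (metis colour.exhaust)

lemma BC_roots_eq:
  "v \<in> BC_roots \<longleftrightarrow>
     (\<exists>i j c. i \<noteq> j \<and> (v = edge_root i j c \<or> v = - edge_root i j c)) \<or>
     (\<exists>k c. v = loop_root k c \<or> v = - loop_root k c)"
  by (simp only: BC_roots_def Un_iff mem_Collect_eq ex_colour edge_root_simps loop_root_simps
      conj_disj_distribL ex_disj_distrib disj_ac)

lemma edge_root_BC_roots:
  assumes "i \<noteq> j"
  shows "edge_root i j c \<in> BC_roots" "- edge_root i j c \<in> BC_roots"
  using assms by (cases c; auto simp: BC_roots_def edge_root_simps)+

lemma loop_root_BC_roots: "loop_root k c \<in> BC_roots" "- loop_root k c \<in> BC_roots"
  by (cases c; auto simp: BC_roots_def loop_root_simps)+

lemma graph_roots_eq: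
  "v \<in> graph_roots G \<longleftrightarrow>
     (\<exists>i j c. straight G i j c \<and> (v = edge_root i j c \<or> v = - edge_root i j c)) \<or>
     (\<exists>k c. loop G k c \<and> (v = loop_root k c \<or> v = - loop_root k c))"
  by (simp only: graph_roots_def Un_iff mem_Collect_eq ex_colour edge_root_simps loop_root_simps
      conj_disj_distribL ex_disj_distrib disj_ac)

lemma straight_sym: "straight G i j c \<longleftrightarrow> straight G j i c"
  by (auto simp: straight_def insert_commute)

section \<open>Recovering a graph from its roots\<close>

text \<open>The support of a root determines the underlying node set; its coefficients up to a common
  sign determine the colour.\<close>

lemma edge_root_inject:
  assumes "i \<noteq> j" "k \<noteq> l" "edge_root i j c = s *s edge_root k l d"
  shows "{i, j} = {k, l} \<and> c = d"
proof -
  have eq: "edge_root i j c $ m = s * edge_root k l d $ m" for m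
    using assms(3) by simp
  have nz: "s \<noteq> 0"
    using eq[of i] assms(1) by (auto simp: edge_root_nth)
  have supp: "m \<in> {i, j} \<longleftrightarrow> m \<in> {k, l}" for m
    using eq[of m] nz assms(1,2) by (auto simp: edge_root_nth split: if_splits)
  then have "{i, j} = {k, l}" by blast
  then consider "i = k" "j = l" | "i = l" "j = k" by (auto simp: doubleton_eq_iff)
  then show ?thesis
  proof cases
    case 1
    then show ?thesis
      using eq[of i] eq[of j] assms(1,2) by (auto simp: edge_root_nth edge_sign_inject)
  next
    case 2
    then show ?thesis
      using eq[of i] eq[of j] assms(1,2)
      by (cases c; cases d) (auto simp: edge_root_nth)
  qed
qed

lemma edge_root_neq_loop_root:
  assumes "i \<noteq> j"
  shows "edge_root i j c \<noteq> s *s loop_root k d"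
proof
  assume "edge_root i j c = s *s loop_root k d"
  then have "edge_root i j c $ m = s * loop_root k d $ m" for m
    by simp
  from this[of i] this[of j] show False
    using assms by (auto simp: edge_root_nth loop_root_nth split: if_splits)
qed

lemma loop_root_inject:
  assumes "loop_root k c = s *s loop_root l d" "s = 1 \<or> s = - 1"
  shows "k = l \<and> c = d"
proof -
  have "loop_root k c $ k = s * loop_root l d $ k"
    using assms(1) by simp
  then show ?thesis
    using assms(2) by (cases c; cases d) (auto simp: loop_root_nth split: if_splits)
qed

lemma vector_neg_eq_smult: "- (v :: complex ^ 'n) = (- 1) *s v"
  by (simp add: vec_eq_iff)

lemma edge_root_in_graph_roots_iff:
  assumes "i \<noteq> j"
  shows "edge_root i j c \<in> graph_roots G \<longleftrightarrow> straight G i j c"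
proof
  assume "edge_root i j c \<in> graph_roots G"
  then obtain k l d s where
    "straight G k l d \<and> edge_root i j c = s *s edge_root k l d \<or>
     edge_root i j c = s *s loop_root k d"
    unfolding graph_roots_eq by (metis vector_neg_eq_smult vector_smult_lid)
  then have *: "straight G k l d" "edge_root i j c = s *s edge_root k l d"
    using edge_root_neq_loop_root[OF assms] by blast+
  then have "{i, j} = {k, l} \<and> c = d"
    using edge_root_inject[OF assms _ *(2)] by (simp add: straight_def)
  then show "straight G i j c"
    using * assms by (simp add: straight_def)
qed (auto simp: graph_roots_eq)

lemma loop_root_in_graph_roots_iff: "loop_root k c \<in> graph_roots G \<longleftrightarrow> loop G k c"
proof
  assume "loop_root k c \<in> graph_roots G"
  moreover have False if s: "straight G i j d"
    and e: "loop_root k c = edge_root i j d \<or> loop_root k c = - edge_root i j d" for i j d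
  proof -
    from e have "edge_root i j d = 1 *s loop_root k c \<or> edge_root i j d = (- 1) *s loop_root k c"
      by (metis vector_neg_eq_smult vector_smult_lid minus_minus)
    with s show False
      using edge_root_neq_loop_root by (metis straight_def)
  qed
  ultimately obtain l d where *: "loop G l d"
    "loop_root k c = 1 *s loop_root l d \<or> loop_root k c = (- 1) *s loop_root l d"
    unfolding graph_roots_eq by (metis vector_neg_eq_smult vector_smult_lid)
  then have "k = l \<and> c = d"
    using loop_root_inject by blast
  then show "loop G k c"
    using * by simp
qed (auto simp: graph_roots_eq)

text \<open>This is the inverse of \<open>graph_roots\<close> on Levi subsystems.\<close>

definition graph_of_roots :: "(complex ^ 'n::finite) set \<Rightarrow> 'n coloured_edges" where
  "graph_of_roots P =
     {({i, j}, c) | i j c. i \<noteq> j \<and> edge_root i j c \<in> P} \<union> {({k}, c) | k c. loop_root k c \<in> P}"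

lemma graph_of_graph_roots:
  assumes "bichromatic_graph G"
  shows "graph_of_roots (graph_roots G) = G"
proof (intro set_eqI iffI)
  fix e assume "e \<in> graph_of_roots (graph_roots G)"
  then show "e \<in> G"
    unfolding graph_of_roots_def
    by (auto simp: edge_root_in_graph_roots_iff loop_root_in_graph_roots_iff
        straight_def loop_def)
next
  fix e assume "e \<in> G"
  obtain S c where e: "e = (S, c)" by force
  with \<open>e \<in> G\<close> assms have "(\<exists>i j. i \<noteq> j \<and> S = {i, j}) \<or> (\<exists>k. S = {k})"
    unfolding bichromatic_graph_def by blast
  then show "e \<in> graph_of_roots (graph_roots G)"
  proof (elim disjE exE conjE)
    fix i j assume "i \<noteq> j" "S = {i, j}"
    then have "edge_root i j c \<in> graph_roots G"
      using \<open>e \<in> G\<close> e by (simp add: edge_root_in_graph_roots_iff straight_def)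
    then show ?thesis
      using \<open>i \<noteq> j\<close> \<open>S = {i, j}\<close> e unfolding graph_of_roots_def by blast
  next
    fix k assume "S = {k}"
    then have "loop_root k c \<in> graph_roots G"
      using \<open>e \<in> G\<close> e by (simp add: loop_root_in_graph_roots_iff loop_def)
    then show ?thesis
      using \<open>S = {k}\<close> e unfolding graph_of_roots_def by blast
  qed
qed

section \<open>Reflections preserve the root system\<close>

text \<open>Up to sign, the roots are the vectors below; this form is visibly stable under linear maps
  that permute the basis vectors up to sign.\<close>

lemma BC_roots_signed_form:
  "v \<in> BC_roots \<longleftrightarrow>
     (\<exists>i j s t. i \<noteq> j \<and> s \<in> {1, - 1} \<and> t \<in> {1, - 1} \<and>
        v = s *s basis_vec i + t *s basis_vec j) \<or>
     (\<exists>k s. s \<in> {1, - 1, 2, - 2} \<and> v = s *s basis_vec k)"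
  (is "_ \<longleftrightarrow> ?E v \<or> ?L v")
proof
  assume "v \<in> BC_roots"
  then show "?E v \<or> ?L v"
    unfolding BC_roots_eq
  proof (elim disjE exE conjE)
    fix i j c assume "i \<noteq> j" "v = edge_root i j c"
    then have "v = 1 *s basis_vec i + (- edge_sign c) *s basis_vec j"
      by (simp add: edge_root_def vec_eq_iff)
    moreover have "- edge_sign c \<in> {1, - 1}" by (cases c) auto
    ultimately show ?thesis using \<open>i \<noteq> j\<close> by blast
  next
    fix i j c assume "i \<noteq> j" "v = - edge_root i j c"
    then have "v = (- 1) *s basis_vec i + edge_sign c *s basis_vec j"
      by (simp add: edge_root_def vec_eq_iff)
    moreover have "edge_sign c \<in> {1, - 1}" by (cases c) auto
    ultimately show ?thesis using \<open>i \<noteq> j\<close> by blast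
  next
    fix k c assume "v = loop_root k c"
    then have "v = loop_coeff c *s basis_vec k"
      by (simp add: loop_root_def)
    moreover have "loop_coeff c \<in> {1, - 1, 2, - 2}"
      by (cases c) auto
    ultimately have "?L v" by blast
    then show ?thesis ..
  next
    fix k c assume "v = - loop_root k c"
    then have "v = (- loop_coeff c) *s basis_vec k"
      by (simp add: loop_root_def vec_eq_iff)
    moreover have "- loop_coeff c \<in> {1, - 1, 2, - 2}"
      by (cases c) auto
    ultimately have "?L v" by blast
    then show ?thesis ..
  qed
next
  assume "?E v \<or> ?L v"
  then show "v \<in> BC_roots"
  proof (elim disjE exE conjE)
    fix i j s t
    assume ij: "i \<noteq> j" and st: "s \<in> {1, - 1}" "t \<in> {1, - 1}"
      and v: "v = s *s basis_vec i + t *s basis_vec j"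
    have "v = edge_root i j (if s = t then Green else Red) \<or>
          v = - edge_root i j (if s = t then Green else Red)"
      using st unfolding v by (auto simp: edge_root_def vec_eq_iff)
    then show ?thesis using edge_root_BC_roots[OF ij] by metis
  next
    fix k s assume "s \<in> {1, - 1, 2, - 2}" "v = s *s basis_vec k"
    then have "v = loop_root k Red \<or> v = - loop_root k Red \<or>
        v = loop_root k Green \<or> v = - loop_root k Green"
      by (auto simp: loop_root_def vec_eq_iff)
    then show ?thesis using loop_root_BC_roots by metis
  qed
qed

lemma BC_roots_closed_under_signed_permutation:
  fixes T :: "complex ^ 'n::finite \<Rightarrow> complex ^ 'n"
  assumes lin: "\<And>v w. T (v + w) = T v + T w" "\<And>c v. T (c *s v) = c *s T v"
    and T: "\<And>i. T (basis_vec i) = \<epsilon> i *s basis_vec (p i)"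
    and eps: "\<And>i. \<epsilon> i = 1 \<or> \<epsilon> i = - 1" and p: "inj p"
    and v: "v \<in> BC_roots"
  shows "T v \<in> BC_roots"
  using v unfolding BC_roots_signed_form[of v]
proof (elim disjE exE conjE)
  fix i j s t
  assume *: "i \<noteq> j" "s \<in> {1, - 1}" "t \<in> {1, - 1}" "v = s *s basis_vec i + t *s basis_vec j"
  then have "T v = (s * \<epsilon> i) *s basis_vec (p i) + (t * \<epsilon> j) *s basis_vec (p j)"
    by (simp add: lin T)
  moreover have "s * \<epsilon> i \<in> {1, - 1}" "t * \<epsilon> j \<in> {1, - 1}" "p i \<noteq> p j"
    using * eps[of i] eps[of j] injD[OF p, of i j] by auto
  ultimately show ?thesis unfolding BC_roots_signed_form by (intro disjI1) blast
next
  fix k s assume *: "s \<in> {1, - 1, 2, - 2}" "v = s *s basis_vec k"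
  then have "T v = (s * \<epsilon> k) *s basis_vec (p k)"
    by (simp add: lin T)
  moreover have "s * \<epsilon> k \<in> {1, - 1, 2, - 2}"
    using * eps[of k] by auto
  ultimately show ?thesis unfolding BC_roots_signed_form by (intro disjI2) blast
qed

lemma orth_reflection_linear:
  "orth_reflection a (v + w) = orth_reflection a v + orth_reflection a w"
  "orth_reflection a (c *s v) = c *s orth_reflection a v"
proof -
  have "scalar_prod (v + w) a = scalar_prod v a + scalar_prod w a"
    by (simp add: scalar_prod_def distrib_right sum.distrib)
  then show "orth_reflection a (v + w) = orth_reflection a v + orth_reflection a w"
    by (simp add: orth_reflection_def vec_eq_iff field_simps add_divide_distrib)
  have "scalar_prod (c *s v) a = c * scalar_prod v a"
    by (simp add: scalar_prod_def sum_distrib_left mult.assoc)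
  then show "orth_reflection a (c *s v) = c *s orth_reflection a v"
    by (simp add: orth_reflection_def vec_eq_iff field_simps)
qed

text \<open>A reflection depends only on the line of its root, so the sign and length of a root can be
  normalised away.\<close>

lemma orth_reflection_smult:
  assumes "s \<noteq> 0"
  shows "orth_reflection (s *s a) v = orth_reflection a v"
proof -
  have "scalar_prod v (s *s a) = cnj s * scalar_prod v a"
    "scalar_prod (s *s a) (s *s a) = s * cnj s * scalar_prod a a"
    by (simp_all add: scalar_prod_def sum_distrib_left algebra_simps)
  then have "2 * scalar_prod v (s *s a) / scalar_prod (s *s a) (s *s a) * s =
      2 * scalar_prod v a / scalar_prod a a"
    using assms by (cases "scalar_prod a a = 0") (auto simp: field_simps)
  then show ?thesis
    unfolding orth_reflection_def by (metis vector_smult_assoc)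
qed

lemma scalar_prod_basis: "scalar_prod (basis_vec i) w = cnj (w $ i)"
proof -
  have "scalar_prod (basis_vec i) w = (\<Sum>j\<in>UNIV. if j = i then cnj (w $ i) else 0)"
    unfolding scalar_prod_def by (rule sum.cong) (auto simp: axis_def)
  then show ?thesis by simp
qed

lemma scalar_prod_diff_left: "scalar_prod (v - c *s w) a = scalar_prod v a - c * scalar_prod w a"
  by (simp add: scalar_prod_def left_diff_distrib sum_subtractf sum_distrib_left mult.assoc)

lemma cnj_edge_sign [simp]: "cnj (edge_sign c) = edge_sign c"
  by (cases c) auto

text \<open>The next two lemmas say that every reflection defined by a root is a signed permutation of the
  basis: a transposition for an edge, a sign change for a loop.\<close>

lemma orth_reflection_edge_root_basis:
  assumes "i \<noteq> j"
  shows "orth_reflection (edge_root i j c) (basis_vec k) =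
    (if k = i \<or> k = j then edge_sign c else 1) *s
      basis_vec (if k = i then j else if k = j then i else k)"
proof -
  have "scalar_prod (edge_root i j c) w = cnj (w $ i) - edge_sign c * cnj (w $ j)" for w
    by (simp add: edge_root_def scalar_prod_diff_left scalar_prod_basis)
  then have "scalar_prod (edge_root i j c) (edge_root i j c) = 2"
    using assms by (simp add: edge_root_nth)
  then show ?thesis
    using assms
    by (auto simp: orth_reflection_def scalar_prod_basis edge_root_nth vec_eq_iff basis_vec_nth)
qed

lemma orth_reflection_basis_basis:
  "orth_reflection (basis_vec i) (basis_vec k) = (if k = i then - 1 else 1) *s basis_vec k"
  by (auto simp: orth_reflection_def scalar_prod_basis vec_eq_iff basis_vec_nth)

lemma orth_reflection_BC_roots:
  assumes a: "a \<in> BC_roots" and v: "v \<in> BC_roots"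
  shows "orth_reflection a v \<in> BC_roots"
proof -
  from a have "(\<exists>i j c s. i \<noteq> j \<and> s \<noteq> 0 \<and> a = s *s edge_root i j c) \<or>
      (\<exists>k s. s \<noteq> 0 \<and> a = s *s basis_vec k)"
    unfolding BC_roots_eq
  proof (elim disjE exE conjE)
    fix i j c assume "i \<noteq> j" "a = edge_root i j c"
    then have "i \<noteq> j \<and> (1 :: complex) \<noteq> 0 \<and> a = 1 *s edge_root i j c" by simp
    then show ?thesis by blast
  next
    fix i j c assume "i \<noteq> j" "a = - edge_root i j c"
    then have "i \<noteq> j \<and> (- 1 :: complex) \<noteq> 0 \<and> a = (- 1) *s edge_root i j c" by simp
    then show ?thesis by blast
  next
    fix k c assume "a = loop_root k c"
    then have "loop_coeff c \<noteq> 0 \<and> a = loop_coeff c *s basis_vec k"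
      by (simp add: loop_root_def)
    then show ?thesis by blast
  next
    fix k c assume "a = - loop_root k c"
    then have "- loop_coeff c \<noteq> 0 \<and> a = (- loop_coeff c) *s basis_vec k"
      by (simp add: loop_root_def vec_eq_iff)
    then show ?thesis by blast
  qed
  then consider (edge) i j c s where "i \<noteq> j" "s \<noteq> 0" "a = s *s edge_root i j c"
    | (loop) k s where "s \<noteq> 0" "a = s *s basis_vec k"
    by blast
  then show ?thesis
  proof cases
    case edge
    have "inj (\<lambda>k. if k = i then j else if k = j then i else k)"
      by (auto simp: inj_on_def split: if_splits)
    then have "orth_reflection (edge_root i j c) v \<in> BC_roots"
      by (intro BC_roots_closed_under_signed_permutation
          [OF orth_reflection_linear orth_reflection_edge_root_basis[OF edge(1)] _ _ v])
        (cases c; auto)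
    then show ?thesis using edge by (simp add: orth_reflection_smult)
  next
    case loop
    have "orth_reflection (basis_vec k) v \<in> BC_roots"
      by (rule BC_roots_closed_under_signed_permutation
          [OF orth_reflection_linear orth_reflection_basis_basis _ _ v]) auto
    then show ?thesis using loop by (simp add: orth_reflection_smult)
  qed
qed

text \<open>Reflecting \<open>v\<close> in \<open>a\<close> adds a multiple of \<open>a\<close> to \<open>v\<close>, so the result stays both in the
  span and among the roots.\<close>

lemma levi_subsystem_iff_span_closed: "levi_subsystem P \<longleftrightarrow> vec.span P \<inter> BC_roots = P"
proof
  assume eq: "vec.span P \<inter> BC_roots = P"
  have "orth_reflection a v \<in> P" if "a \<in> P" "v \<in> P" for a v
  proof -
    have "orth_reflection a v \<in> vec.span P"
      unfolding orth_reflection_def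
      using that by (intro vec.span_diff vec.span_scale vec.span_base)
    moreover have "orth_reflection a v \<in> BC_roots"
      using that eq orth_reflection_BC_roots by blast
    ultimately show ?thesis using eq by blast
  qed
  then show "levi_subsystem P"
    unfolding levi_subsystem_def root_subsystem_def using eq by auto
qed (simp add: levi_subsystem_def)

section \<open>The graph of a Levi subsystem\<close>

context
  fixes P :: "(complex ^ 'n::finite) set"
  assumes closed: "vec.span P \<inter> BC_roots = P"
begin

lemma edge_root_mem_iff_span: "i \<noteq> j \<Longrightarrow> edge_root i j c \<in> P \<longleftrightarrow> edge_root i j c \<in> vec.span P"
  using closed vec.span_base edge_root_BC_roots(1) by blast

lemma straight_graph_of_roots_iff:
  "straight (graph_of_roots P) i j c \<longleftrightarrow> i \<noteq> j \<and> edge_root i j c \<in> vec.span P"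
proof -
  have flip: "edge_root j i c \<in> P \<longleftrightarrow> edge_root i j c \<in> P" if "i \<noteq> j" for i j
    using that edge_root_mem_iff_span edge_root_commute
    by (metis vec.span_neg vec.span_scale)
  have "straight (graph_of_roots P) i j c \<longleftrightarrow> i \<noteq> j \<and> edge_root i j c \<in> P"
    using flip by (auto simp: straight_def graph_of_roots_def doubleton_eq_iff)
  then show ?thesis using edge_root_mem_iff_span by blast
qed

text \<open>Both loop roots at \<open>k\<close> are multiples of \<open>e\<^sub>k\<close>, hence the colour does not matter here.\<close>

lemma loop_graph_of_roots_iff:
  "loop (graph_of_roots P) k c \<longleftrightarrow> basis_vec k \<in> vec.span P"
proof -
  have "loop (graph_of_roots P) k c \<longleftrightarrow> loop_root k c \<in> P"
    by (auto simp: loop_def graph_of_roots_def)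
  also have "\<dots> \<longleftrightarrow> loop_root k c \<in> vec.span P"
    using closed vec.span_base loop_root_BC_roots(1) by blast
  also have "\<dots> \<longleftrightarrow> basis_vec k \<in> vec.span P"
  proof -
    have "basis_vec k = (1 / loop_coeff c) *s loop_root k c"
      by (simp add: loop_root_def)
    then show ?thesis
      by (metis loop_root_def vec.span_scale)
  qed
  finally show ?thesis .
qed

text \<open>Each axiom is one linear combination: composing edges adds their roots up to sign, a double
  edge gives \<open>e\<^sub>i\<close> as the mean of \<open>e\<^sub>i - e\<^sub>j\<close> and \<open>e\<^sub>i + e\<^sub>j\<close>, and \<open>e\<^sub>i\<close> together with
  one edge root yields \<open>e\<^sub>j\<close>, hence both edges.\<close>

lemma levigraph_graph_of_roots: "levigraph (graph_of_roots P)"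
proof -
  let ?W = "vec.span P"
  have edge: "edge_root i j c \<in> ?W" if "basis_vec i \<in> ?W" "basis_vec j \<in> ?W" for i j c
    unfolding edge_root_def using that by (intro vec.span_diff vec.span_scale)
  have other_end: "basis_vec j \<in> ?W" if "basis_vec i \<in> ?W" "edge_root i j d \<in> ?W" for i j d
  proof -
    have "basis_vec j = edge_sign d *s (basis_vec i - edge_root i j d)"
      by (cases d) (auto simp: edge_root_def)
    then show ?thesis using that by (metis vec.span_diff vec.span_scale)
  qed
  have compose: "edge_root i k (if c = d then Red else Green) \<in> ?W"
    if "edge_root i j c \<in> ?W" "edge_root j k d \<in> ?W" for i j k c d
  proof -
    have "edge_root i k (if c = d then Red else Green) =
        edge_root i j c + edge_sign c *s edge_root j k d"
      unfolding edge_root_def edge_sign_compose by (simp add: vec_eq_iff algebra_simps)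
    then show ?thesis using that by (metis vec.span_add vec.span_scale)
  qed
  have mean: "basis_vec i \<in> ?W" if "edge_root i j Red \<in> ?W" "edge_root i j Green \<in> ?W" for i j
  proof -
    have "basis_vec i = (1 / 2) *s (edge_root i j Red + edge_root i j Green)"
      by (auto simp: edge_root_def vec_eq_iff)
    then show ?thesis using that by (metis vec.span_add vec.span_scale)
  qed
  have "bichromatic_graph (graph_of_roots P)"
    unfolding bichromatic_graph_def graph_of_roots_def by blast
  then show ?thesis
    unfolding levigraph_def crystallograph_def straight_graph_of_roots_iff loop_graph_of_roots_iff
    using edge other_end compose mean by (intro conjI allI impI) (blast | metis)+
qed

lemma graph_roots_graph_of_roots: "graph_roots (graph_of_roots P) = P"
proof (rule set_eqI)
  fix v
  have neg: "- w \<in> P \<longleftrightarrow> w \<in> P" if "w \<in> BC_roots" for w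
  proof -
    have "- w \<in> BC_roots" using that unfolding BC_roots_eq by (metis minus_minus)
    moreover have "x \<in> P \<longleftrightarrow> x \<in> vec.span P" if "x \<in> BC_roots" for x
      using that closed by blast
    ultimately show ?thesis
      using that vec.span_neg by (metis minus_minus)
  qed
  have edge: "straight (graph_of_roots P) i j c \<longleftrightarrow> i \<noteq> j \<and> edge_root i j c \<in> P" for i j c
    using straight_graph_of_roots_iff edge_root_mem_iff_span by blast
  have loop: "loop (graph_of_roots P) k c \<longleftrightarrow> loop_root k c \<in> P" for k c
    by (auto simp: loop_def graph_of_roots_def)
  show "v \<in> graph_roots (graph_of_roots P) \<longleftrightarrow> v \<in> P"
  proof
    assume "v \<in> graph_roots (graph_of_roots P)"
    then show "v \<in> P"
      unfolding graph_roots_eq edge loop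
      using neg edge_root_BC_roots(1) loop_root_BC_roots(1) by metis
  next
    assume v: "v \<in> P"
    then have "(\<exists>i j c. i \<noteq> j \<and> (v = edge_root i j c \<or> v = - edge_root i j c)) \<or>
        (\<exists>k c. v = loop_root k c \<or> v = - loop_root k c)"
      using closed unfolding BC_roots_eq[symmetric] by blast
    then show "v \<in> graph_roots (graph_of_roots P)"
      unfolding graph_roots_eq edge loop
      using v neg edge_root_BC_roots(1) loop_root_BC_roots(1) by metis
  qed
qed

end

section \<open>The subsystem of a Levigraph\<close>

text \<open>The weight is only meaningful at a node \<open>k\<close> of a Levigraph that has no loops: there no two
  edges to the same neighbour have different colours, so trying red first loses nothing.\<close>

definition node_weight :: "'n coloured_edges \<Rightarrow> 'n \<Rightarrow> 'n \<Rightarrow> complex" where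
  "node_weight G k j =
     (if j = k \<or> straight G k j Red then 1 else if straight G k j Green then - 1 else 0)"

definition node_equation :: "'n::finite coloured_edges \<Rightarrow> 'n \<Rightarrow> complex ^ 'n \<Rightarrow> complex" where
  "node_equation G k v = (\<Sum>j\<in>UNIV. node_weight G k j * v $ j)"

lemma node_equation_linear [simp]:
  "node_equation G k 0 = 0"
  "node_equation G k (v + w) = node_equation G k v + node_equation G k w"
  "node_equation G k (v - w) = node_equation G k v - node_equation G k w"
  "node_equation G k (- v) = - node_equation G k v"
  "node_equation G k (c *s v) = c * node_equation G k v"
  by (simp_all add: node_equation_def distrib_left right_diff_distrib sum.distrib sum_subtractf
      sum_negf sum_distrib_left mult.left_commute)

lemma node_equation_basis [simp]: "node_equation G k (basis_vec i) = node_weight G k i"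
proof -
  have "node_equation G k (basis_vec i) = (\<Sum>j\<in>UNIV. if j = i then node_weight G k i else 0)"
    unfolding node_equation_def by (rule sum.cong) (auto simp: axis_def)
  then show ?thesis by simp
qed

context
  fixes G :: "'n::finite coloured_edges"
  assumes levi: "levigraph G"
begin

lemma straight_compose:
  assumes "i \<noteq> j" "j \<noteq> k" "i \<noteq> k" "straight G i j c" "straight G j k d"
  shows "straight G i k (if c = d then Red else Green)"
proof -
  have "\<forall>i j k c d. i \<noteq> j \<and> j \<noteq> k \<and> i \<noteq> k \<and> straight G i j c \<and> straight G j k d \<longrightarrow>
      straight G i k (if c = d then Red else Green)"
    using levi unfolding levigraph_def crystallograph_def by (elim conjE)
  then show ?thesis using assms by metis
qed

lemma loop_along_edge:
  assumes "loop G i c" "straight G i j d"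
  shows "loop G j c"
proof -
  have "\<forall>i j c d. loop G i c \<and> straight G i j d \<longrightarrow>
      straight G i j Red \<and> straight G i j Green \<and> loop G j c"
    using levi unfolding levigraph_def crystallograph_def by (elim conjE)
  then show ?thesis using assms by metis
qed

lemma loop_every_colour:
  assumes "loop G i c"
  shows "loop G i d"
proof -
  have "\<forall>i. (\<exists>c. loop G i c) \<longrightarrow> loop G i Red \<and> loop G i Green"
    using levi unfolding levigraph_def by (elim conjE)
  then show ?thesis using assms by (cases d) metis+
qed

lemma double_edge_loop:
  assumes "straight G i j Red" "straight G i j Green"
  shows "loop G i c"
proof -
  have "\<forall>i j. straight G i j Red \<and> straight G i j Green \<longrightarrow>
      loop G i Red \<and> loop G i Green \<and> loop G j Red \<and> loop G j Green"
    using levi unfolding levigraph_def by (elim conjE)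
  then show ?thesis using assms by (cases c) metis+
qed

lemma loops_edge:
  assumes "i \<noteq> j" "loop G i c" "loop G j d"
  shows "straight G i j e"
proof -
  have "\<forall>i j. i \<noteq> j \<and> (\<exists>c. loop G i c) \<and> (\<exists>d. loop G j d) \<longrightarrow>
      straight G i j Red \<and> straight G i j Green"
    using levi unfolding levigraph_def by (elim conjE)
  then show ?thesis using assms by (cases e) metis+
qed

lemma node_weight_edge:
  assumes "\<not> loop G k e" "straight G k j c"
  shows "node_weight G k j = edge_sign c"
  using assms double_edge_loop[of k j e] by (cases c) (auto simp: node_weight_def straight_def)

lemma node_weight_eq_edge_signD:
  assumes "k \<noteq> j" "node_weight G k j = edge_sign c"
  shows "straight G k j c"
  using assms by (cases c) (auto simp: node_weight_def split: if_splits)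

text \<open>Moving along an edge multiplies the weight by the sign of that edge: this is the
  composition rule of crystallographs read at a node \<open>k\<close> without loops.\<close>

lemma node_weight_along_edge:
  assumes k: "\<not> loop G k e" and ij: "straight G i j c"
  shows "node_weight G k i = edge_sign c * node_weight G k j"
proof -
  have ne: "i \<noteq> j" using ij by (simp add: straight_def)
  consider "k = i" | "k = j" | "k \<noteq> i" "k \<noteq> j" by blast
  then show ?thesis
  proof cases
    case 1
    then show ?thesis
      using node_weight_edge[OF k, of j c] ij by (simp add: node_weight_def[of G i i])
  next
    case 2
    then show ?thesis
      using node_weight_edge[OF k, of i c] ij straight_sym[of G i j c]
      by (simp add: node_weight_def[of G j j])
  next
    case 3
    \<comment> \<open>Stated for arbitrary endpoints because the edge from \<open>k\<close> may reach either \<open>i\<close> or \<open>j\<close>.\<close>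
    have step: "node_weight G k b = edge_sign c * node_weight G k a"
      if "straight G k a d" "straight G a b c" "k \<noteq> a" "k \<noteq> b" for a b d
    proof -
      have "straight G k b (if d = c then Red else Green)"
        using straight_compose[of k a b d c] that by (auto simp: straight_def)
      then show ?thesis
        using node_weight_edge[OF k] that(1) edge_sign_compose by (simp add: mult.commute)
    qed
    show ?thesis
    proof (cases "\<exists>d. straight G k j d")
      case True
      then show ?thesis using step[of j _ i] 3 ij straight_sym[of G i j c] by blast
    next
      case no_j: False
      show ?thesis
      proof (cases "\<exists>d. straight G k i d")
        case True
        then show ?thesis
          using no_j straight_compose[of k i j] 3 ij ne by metis
      next
        case False
        with no_j 3 show ?thesis by (simp add: node_weight_def)
      qed
    qed
  qed
qed

text \<open>Loops propagate along edges, so a node without loops has no neighbour with loops.\<close>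

lemma node_weight_loop:
  assumes "\<not> loop G k e" "loop G i c"
  shows "node_weight G k i = 0"
proof -
  have "i \<noteq> k" using assms loop_every_colour by blast
  moreover have "\<not> straight G k i d" for d
    using assms loop_along_edge loop_every_colour straight_sym by metis
  ultimately show ?thesis by (simp add: node_weight_def)
qed

text \<open>An edge root has value \<open>0\<close> because the weights at its endpoints differ exactly by the sign
  of the edge; a loop root because its node is not adjacent to \<open>k\<close>.\<close>

lemma node_equation_graph_roots:
  assumes k: "\<not> loop G k e" and v: "v \<in> graph_roots G"
  shows "node_equation G k v = 0"
proof -
  have "node_equation G k (edge_root i j c) = 0" if "straight G i j c" for i j c
    using node_weight_along_edge[OF k that] by (simp add: edge_root_def)
  moreover have "node_equation G k (loop_root i c) = 0" if "loop G i c" for i c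
    using node_weight_loop[OF k that] by (simp add: loop_root_def)
  ultimately show ?thesis
    using v unfolding graph_roots_eq by (elim disjE exE conjE) simp_all
qed

lemma node_equation_span:
  assumes k: "\<not> loop G k e" and v: "v \<in> vec.span (graph_roots G)"
  shows "node_equation G k v = 0"
proof -
  have "vec.subspace {v. node_equation G k v = 0}"
    unfolding vec.subspace_def by simp
  moreover have "graph_roots G \<subseteq> {v. node_equation G k v = 0}"
    using node_equation_graph_roots[OF k] by blast
  ultimately show ?thesis
    using v vec.span_minimal by blast
qed

text \<open>If an endpoint has no loops, its equation computes its weight towards the other endpoint as
  the sign \<open>\<sigma>\<close>, which only an edge of that colour produces. If both have loops, the Levigraph
  axioms supply every edge between them.\<close>

lemma edge_root_span_imp_straight:
  assumes ij: "i \<noteq> j" and span: "edge_root i j c \<in> vec.span (graph_roots G)"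
  shows "straight G i j c"
proof -
  have at_loopless: "straight G k l c"
    if "k \<noteq> l" "\<not> loop G k Red" "edge_root k l c \<in> vec.span (graph_roots G)" for k l
  proof -
    have "1 - edge_sign c * node_weight G k l = 0"
      using node_equation_span[OF that(2,3)] by (simp add: edge_root_def node_weight_def[of G k k])
    then have "node_weight G k l = edge_sign c"
      by (cases c) (auto simp: add_eq_0_iff)
    then show ?thesis using node_weight_eq_edge_signD that(1) by blast
  qed
  have "edge_root j i c \<in> vec.span (graph_roots G)"
    using span unfolding edge_root_commute[of j i] by (intro vec.span_neg vec.span_scale)
  then show ?thesis
    using at_loopless[of i j] at_loopless[of j i] ij span loops_edge[of i j Red Red c]
      straight_sym[of G i j c] by metis
qed

lemma loop_root_span_imp_loop:
  assumes span: "loop_root k c \<in> vec.span (graph_roots G)"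
  shows "loop G k c"
proof (rule ccontr)
  assume "\<not> loop G k c"
  then have "node_equation G k (loop_root k c) = 0"
    using span by (rule node_equation_span)
  then show False
    by (cases c) (simp_all add: loop_root_def node_weight_def)
qed

lemma levi_subsystem_graph_roots: "levi_subsystem (graph_roots G)"
  unfolding levi_subsystem_iff_span_closed
proof (intro equalityI subsetI IntI)
  fix v assume v: "v \<in> vec.span (graph_roots G) \<inter> BC_roots"
  then have "- v \<in> vec.span (graph_roots G)" by (simp add: vec.span_neg)
  with v show "v \<in> graph_roots G"
    unfolding Int_iff BC_roots_eq graph_roots_eq[of v]
    using edge_root_span_imp_straight loop_root_span_imp_loop by (metis minus_minus)
next
  fix v assume v: "v \<in> graph_roots G"
  then show "v \<in> vec.span (graph_roots G)" by (rule vec.span_base)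
  show "v \<in> BC_roots"
    using v edge_root_BC_roots loop_root_BC_roots
    unfolding graph_roots_eq straight_def by metis
qed

end

section \<open>The bijection\<close>

theorem theorem9p1p4:
  shows "bij_betw (graph_roots :: 'n::finite coloured_edges \<Rightarrow> (complex ^ 'n) set)
           {G. levigraph G} {P. levi_subsystem P}"
proof (rule bij_betw_byWitness[where f' = graph_of_roots])
  show "\<forall>G\<in>{G. levigraph G}. graph_of_roots (graph_roots G) = (G :: 'n coloured_edges)"
    by (simp add: graph_of_graph_roots levigraph_def crystallograph_def)
  show "\<forall>P\<in>{P. levi_subsystem P}. graph_roots (graph_of_roots P) = (P :: (complex ^ 'n) set)"
    by (simp add: graph_roots_graph_of_roots levi_subsystem_iff_span_closed)
  show "graph_roots ` {G :: 'n coloured_edges. levigraph G} \<subseteq> {P. levi_subsystem P}"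
    by (auto intro: levi_subsystem_graph_roots)
  show "graph_of_roots ` {P :: (complex ^ 'n) set. levi_subsystem P} \<subseteq> {G. levigraph G}"
    by (auto intro: levigraph_graph_of_roots simp: levi_subsystem_iff_span_closed)
qed

end
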